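(* Let $C$ be a Cantor fan and let $L$ be a Lelek fan. Then every embedding $f:C\to L$ admits a retraction, i.e. for every embedding $f:C\to L$ there is a continuous map $r:L\to f(C)$ with $r(y)=y$ for all $y\in f(C)$.
   Context: A continuum is a nonempty compact connected metric space. A dendroid is an arcwise connected, hereditarily unicoherent continuum. A point $x$ of a dendroid $X$ is a ramification point if $x$ is the top (the branch point) of some simple triod in $X$. A fan is a dendroid with at most one ramification point; this point, if it exists, is called the top of the fan. For a fan $X$, a point $x$ is an end point of $X$ if $x$ is an end point of every arc in $X$ containing $x$; $E(X)$ denotes the set of end points of $X$. A fan $X$ with top $v$ is smooth if for every $x\in X$ and every sequence $x_n\to x$ in $X$, the arcs from $v$ to $x_n$ converge (in the Hausdorff metric) to the arc from $v$ to $x$. A Lelek fan is a smooth fan $X$ with $\mathrm{Cl}(E(X))=X$. A Cantor fan is a continuum homeomorphic to $\bigcup_{c\in C}A_c\subseteq\mathbb R^2$, where $C\subseteq[0,1]$ is the Cantor middle-third set and $A_c$ is the straight segment from $(\tfrac12,0)$ to $(c,1)$. An embedding is a continuous map that is a homeomorphism onto its image. A retraction from a space $X$ onto a subspace $Y$ is a continuous map $r:X\to Y$ with $r(y)=y$ for all $y\in Y$; an embedding $f:X\to Z$ admits a retraction if there is a retraction from $Z$ onto $f(X)$. *)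

theory Defs
  imports "HOL-Analysis.Analysis"
begin

definition continuum :: "'a::metric_space set \<Rightarrow> bool" where
  "continuum X \<longleftrightarrow> X \<noteq> {} \<and> compact X \<and> connected X"

text \<open>An arc in X with end points x and y (arcs are injective paths; their images are
  exactly the subsets homeomorphic to [0,1]).\<close>
definition arc_in :: "'a::metric_space set \<Rightarrow> 'a \<Rightarrow> 'a \<Rightarrow> 'a set \<Rightarrow> bool" where
  "arc_in X x y A \<longleftrightarrow> (\<exists>g. arc g \<and> path_image g = A \<and> A \<subseteq> X \<and>
                             pathstart g = x \<and> pathfinish g = y)"

definition arcwise_connected :: "'a::metric_space set \<Rightarrow> bool" where
  "arcwise_connected X \<longleftrightarrow> (\<forall>x\<in>X. \<forall>y\<in>X. x \<noteq> y \<longrightarrow> (\<exists>A. arc_in X x y A))"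

definition hereditarily_unicoherent :: "'a::metric_space set \<Rightarrow> bool" where
  "hereditarily_unicoherent X \<longleftrightarrow>
     (\<forall>A B. A \<subseteq> X \<and> B \<subseteq> X \<and> continuum A \<and> continuum B \<longrightarrow> connected (A \<inter> B))"

definition dendroid :: "'a::metric_space set \<Rightarrow> bool" where
  "dendroid X \<longleftrightarrow> continuum X \<and> arcwise_connected X \<and> hereditarily_unicoherent X"

definition simple_triod_top :: "'a::metric_space set \<Rightarrow> 'a \<Rightarrow> bool" where
  "simple_triod_top T x \<longleftrightarrow> (\<exists>g1 g2 g3. arc g1 \<and> arc g2 \<and> arc g3 \<and>
      pathstart g1 = x \<and> pathstart g2 = x \<and> pathstart g3 = x \<and>
      path_image g1 \<inter> path_image g2 = {x} \<and> path_image g1 \<inter> path_image g3 = {x} \<and>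
      path_image g2 \<inter> path_image g3 = {x} \<and>
      T = path_image g1 \<union> path_image g2 \<union> path_image g3)"

definition ramification_point :: "'a::metric_space set \<Rightarrow> 'a \<Rightarrow> bool" where
  "ramification_point X x \<longleftrightarrow> (\<exists>T. T \<subseteq> X \<and> simple_triod_top T x)"

definition fan :: "'a::metric_space set \<Rightarrow> bool" where
  "fan X \<longleftrightarrow> dendroid X \<and>
     (\<forall>x y. ramification_point X x \<and> ramification_point X y \<longrightarrow> x = y)"

definition fan_top :: "'a::metric_space set \<Rightarrow> 'a \<Rightarrow> bool" where
  "fan_top X v \<longleftrightarrow> fan X \<and> ramification_point X v"

definition end_points :: "'a::metric_space set \<Rightarrow> 'a set" where
  "end_points X = {x \<in> X. \<forall>g. arc g \<and> path_image g \<subseteq> X \<and> x \<in> path_image g \<longrightarrow>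
                                  x = pathstart g \<or> x = pathfinish g}"

text \<open>The (unique, in a dendroid) arc from v to x; degenerate {v} when x = v.\<close>
definition arc_from :: "'a::metric_space set \<Rightarrow> 'a \<Rightarrow> 'a \<Rightarrow> 'a set" where
  "arc_from X v x = (if x = v then {v} else (THE A. arc_in X v x A))"

text \<open>Hausdorff distance between (nonempty bounded) sets of a metric space.\<close>
definition hausdorff_dist :: "'a::metric_space set \<Rightarrow> 'a set \<Rightarrow> real" where
  "hausdorff_dist A B = max (SUP a\<in>A. infdist a B) (SUP b\<in>B. infdist b A)"

definition smooth_fan :: "'a::metric_space set \<Rightarrow> 'a \<Rightarrow> bool" where
  "smooth_fan X v \<longleftrightarrow> fan_top X v \<and>
     (\<forall>x\<in>X. \<forall>s. (\<forall>n. s n \<in> X) \<and> s \<longlonglongrightarrow> x \<longrightarrow>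
        (\<lambda>n. hausdorff_dist (arc_from X v (s n)) (arc_from X v x)) \<longlonglongrightarrow> 0)"

definition lelek_fan :: "'a::metric_space set \<Rightarrow> bool" where
  "lelek_fan X \<longleftrightarrow> (\<exists>v. smooth_fan X v) \<and> closure (end_points X) = X"

definition cantor_set :: "real set" where
  "cantor_set = {x. \<exists>d::nat \<Rightarrow> nat. (\<forall>n. d n \<in> {0, 2}) \<and>
                    x = (\<Sum>n. real (d n) / 3 ^ (Suc n))}"

definition standard_cantor_fan :: "(real \<times> real) set" where
  "standard_cantor_fan = (\<Union>c\<in>cantor_set. closed_segment (1/2, 0) (c, 1))"

definition cantor_fan :: "'a::metric_space set \<Rightarrow> bool" where
  "cantor_fan X \<longleftrightarrow> X homeomorphic standard_cantor_fan"

definition embedding_into :: "('a::metric_space \<Rightarrow> 'b::metric_space) \<Rightarrow> 'a set \<Rightarrow> 'b set \<Rightarrow> bool" where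
  "embedding_into f X Z \<longleftrightarrow> f ` X \<subseteq> Z \<and> (\<exists>g. homeomorphism X (f ` X) f g)"

end

theory Submission
  imports Defs
begin

text \<open>
  An embedding of the Cantor fan maps its top to the top \<open>v\<close> of the smooth fan \<open>L\<close>, since both are
  tops of triods. Give the image \<open>Y\<close> cone coordinates \<open>(c, t)\<close>. It suffices to extend \<open>t\<close>
  continuously to \<open>L\<close> and \<open>c\<close> continuously to a map from \<open>L - {v}\<close> into the Cantor set: the point
  with the extended coordinates then depends continuously on the given point, also at \<open>v\<close>, where
  \<open>t = 0\<close>. Tietze's theorem extends \<open>t\<close>. Extending \<open>c\<close> one ternary digit at a time amounts to
  extending partitions of \<open>Y - {v}\<close> into two clopen sets to \<open>L - {v}\<close>. By smoothness the height of
  \<open>x\<close>, the largest distance from \<open>v\<close> on the arc from \<open>v\<close> to \<open>x\<close>, is continuous, so \<open>L - {v}\<close> is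
  exhausted by the compact sets \<open>height \<ge> \<epsilon>\<close>. A continuum avoiding \<open>v\<close> lies on one leg and meets
  such a set in a connected set; hence each partition extends from one of these sets to the next, two
  disjoint compact sets in a compact space being separated by clopen sets when no connected set meets
  both.
\<close>

subsection \<open>Arcs and the Hausdorff distance\<close>

text \<open>Pulled back to the parameter interval, \<open>S\<close> becomes a connected set
  containing 0 and 1, hence all of it.\<close>

lemma connected_subset_arc_eq:
  fixes g :: "real \<Rightarrow> 'a::metric_space"
  assumes "arc g" "connected S" "S \<subseteq> path_image g" "pathstart g \<in> S" "pathfinish g \<in> S"
  shows "S = path_image g"
proof -
  obtain h where h: "homeomorphism {0..1} (path_image g) g h"
    using homeomorphism_arc[OF assms(1)] .
  have "connected (h ` S)"
    using h assms(2,3) by (meson connected_continuous_image continuous_on_subset homeomorphism_def)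
  moreover have "h (g 0) = 0" "h (g 1) = 1"
    using h by (auto simp: homeomorphism_def)
  then have "0 \<in> h ` S" "1 \<in> h ` S"
    using assms(4,5) by (auto simp: pathstart_def pathfinish_def intro: rev_image_eqI)
  ultimately have I: "{0..1} \<subseteq> h ` S"
    by (meson connected_contains_Icc)
  have "path_image g \<subseteq> S"
  proof
    fix y assume y: "y \<in> path_image g"
    then have "h y \<in> {0..1}" using h by (auto simp: homeomorphism_def)
    then obtain z where "z \<in> S" "h y = h z" using I by auto
    then show "y \<in> S"
      using y assms(3) h by (metis homeomorphism_def subsetD)
  qed
  with assms(3) show ?thesis by blast
qed

text \<open>The affine reparametrization also covers \<open>t < s\<close>, so the subarc may run
  backwards; the triod below uses one that runs back to the top.\<close>

lemma subarc:
  fixes g :: "real \<Rightarrow> 'a::metric_space"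
  assumes "arc g" "s \<in> {0..1}" "t \<in> {0..1}" "s \<noteq> t"
  obtains k where "arc k" "pathstart k = g s" "pathfinish k = g t"
    "path_image k = g ` closed_segment s t"
proof
  let ?l = "\<lambda>x. (t - s) * x + s"
  have im: "?l ` {0..1} = closed_segment s t"
    by (simp add: closed_segment_real_eq)
  have sub: "closed_segment s t \<subseteq> {0..1}"
    using assms(2,3) by (auto simp: closed_segment_eq_real_ivl)
  show "arc (g \<circ> ?l)"
    unfolding arc_def path_def
  proof
    show "continuous_on {0..1} (g \<circ> ?l)"
      using assms(1) sub unfolding arc_def path_def
      by (intro continuous_on_compose continuous_intros) (auto simp: im intro: continuous_on_subset)
    show "inj_on (g \<circ> ?l) {0..1}"
      using assms(1,4) sub im unfolding arc_def
      by (intro comp_inj_on) (auto simp: inj_on_def inj_on_subset)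
  qed
  show "path_image (g \<circ> ?l) = g ` closed_segment s t"
    by (simp only: path_image_def image_comp[symmetric] im)
qed (auto simp: pathstart_def pathfinish_def)

text \<open>Hereditary unicoherence makes the intersection of the arc with \<open>T\<close>
  connected, and it contains both ends of the arc. This yields uniqueness of arcs, and it forces
  continua through \<open>v\<close>.\<close>

lemma arc_subset_continuum:
  assumes "hereditarily_unicoherent X" "arc g" "path_image g \<subseteq> X"
    "continuum T" "T \<subseteq> X" "pathstart g \<in> T" "pathfinish g \<in> T"
  shows "path_image g \<subseteq> T"
proof -
  have "continuum (path_image g)"
    using assms(2) by (simp add: continuum_def arc_imp_path compact_path_image connected_path_image)
  then have "connected (path_image g \<inter> T)"
    using assms unfolding hereditarily_unicoherent_def by blast
  then have "path_image g \<inter> T = path_image g"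
    using connected_subset_arc_eq[OF assms(2), of "path_image g \<inter> T"] assms(6,7)
    by (simp add: pathstart_in_path_image pathfinish_in_path_image)
  then show ?thesis by blast
qed

lemma continuum_union:
  assumes "continuum A" "continuum B" "A \<inter> B \<noteq> {}"
  shows "continuum (A \<union> B)"
  using assms by (auto simp: continuum_def intro: connected_Un)

text \<open>Every point of one compact set has a nearest point in the other, at distance
  \<open>infdist\<close>, so the triangle inequality bounds each supremum by the other. This later
  turns Hausdorff convergence of legs into convergence of heights.\<close>

lemma abs_sup_dist_diff_le_hausdorff_dist:
  fixes A B :: "'a::metric_space set"
  assumes "compact A" "compact B" "A \<noteq> {}" "B \<noteq> {}"
  shows "\<bar>(SUP a\<in>A. dist v a) - (SUP b\<in>B. dist v b)\<bar> \<le> hausdorff_dist A B"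
proof -
  have bdd: "bdd_above (f ` C)" if "compact C" "continuous_on C f" for C and f :: "'a \<Rightarrow> real"
    using that by (simp add: bounded_imp_bdd_above compact_continuous_image compact_imp_bounded)
  have le: "(SUP a\<in>A. dist v a) \<le> (SUP b\<in>B. dist v b) + (SUP a\<in>A. infdist a B)"
    if "compact A" "compact B" "A \<noteq> {}" "B \<noteq> {}" for A B :: "'a set"
  proof (rule cSUP_least[OF that(3)])
    note AB = that
    fix a assume a: "a \<in> A"
    obtain b where b: "b \<in> B" "\<forall>c\<in>B. dist a b \<le> dist a c"
      using continuous_attains_inf[OF AB(2,4), of "dist a"]
      by (auto simp: continuous_on_dist continuous_on_id)
    then have "dist a b \<le> infdist a B"
      by (simp add: infdist_def AB(4) cINF_greatest)
    have "dist v a \<le> dist v b + dist a b"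
      by (metis dist_commute dist_triangle)
    moreover have "dist v b \<le> (SUP b\<in>B. dist v b)"
      using b AB by (intro cSUP_upper bdd continuous_intros)
    moreover have "infdist a B \<le> (SUP a\<in>A. infdist a B)"
      using a AB by (intro cSUP_upper bdd continuous_intros)
    ultimately show "dist v a \<le> (SUP b\<in>B. dist v b) + (SUP a\<in>A. infdist a B)"
      using \<open>dist a b \<le> infdist a B\<close> by linarith
  qed
  show ?thesis
    using le[OF assms] le[OF assms(2,1,4,3)] unfolding hausdorff_dist_def by linarith
qed

subsection \<open>The legs of a smooth fan\<close>

locale smooth_fan_space =
  fixes L :: "'a::metric_space set" and v :: 'a
  assumes smooth: "smooth_fan L v"
begin

abbreviation leg :: "'a \<Rightarrow> 'a set" where "leg x \<equiv> arc_from L v x"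

lemma L_compact: "compact L" and L_hu: "hereditarily_unicoherent L"
  and L_arcwise: "arcwise_connected L" and ram_v: "ramification_point L v"
  using smooth by (simp_all add: smooth_fan_def fan_top_def fan_def dendroid_def continuum_def)

lemma ram_eq: "ramification_point L x \<Longrightarrow> x = v"
  using smooth ram_v unfolding smooth_fan_def fan_top_def fan_def by blast

lemma v_in_L: "v \<in> L"
proof -
  obtain T where "T \<subseteq> L" "simple_triod_top T v"
    using ram_v unfolding ramification_point_def by blast
  then obtain g where "path_image g \<subseteq> L" "pathstart g = v"
    unfolding simple_triod_top_def by blast
  then show ?thesis using pathstart_in_path_image[of g] by blast
qed

text \<open>Two arcs with the same ends contain each other by \<open>arc_subset_continuum\<close>,
  so the definite description in \<open>arc_from\<close> is justified.\<close>

lemma leg_eq_path_image: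
  assumes "arc g" "path_image g \<subseteq> L" "pathstart g = v" "pathfinish g = x"
  shows "leg x = path_image g"
proof -
  have ne: "x \<noteq> v" using arc_distinct_ends[OF assms(1)] assms(3,4) by simp
  have "arc_in L v x (path_image g)"
    using assms by (auto simp: arc_in_def)
  moreover have "B = path_image g" if B: "arc_in L v x B" for B
  proof -
    obtain h where h: "arc h" "path_image h = B" "B \<subseteq> L" "pathstart h = v" "pathfinish h = x"
      using B unfolding arc_in_def by blast
    have "continuum (path_image k)" if "arc k" for k :: "real \<Rightarrow> 'a"
      using that by (simp add: continuum_def arc_imp_path compact_path_image connected_path_image)
    then show ?thesis
      using arc_subset_continuum[OF L_hu] h assms
      by (metis pathfinish_in_path_image pathstart_in_path_image subset_antisym)
  qed
  ultimately have "(THE A. arc_in L v x A) = path_image g"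
    by (rule the_equality)
  then show ?thesis
    using ne by (simp add: arc_from_def)
qed

lemma leg_path:
  assumes "x \<in> L" "x \<noteq> v"
  obtains g where "arc g" "path_image g = leg x" "leg x \<subseteq> L" "pathstart g = v" "pathfinish g = x"
proof -
  obtain A where "arc_in L v x A"
    using L_arcwise assms v_in_L unfolding arcwise_connected_def by metis
  then show ?thesis
    using leg_eq_path_image that unfolding arc_in_def by metis
qed

lemma leg_v [simp]: "leg v = {v}"
  by (simp add: arc_from_def)

lemma leg_props:
  assumes "x \<in> L"
  shows "continuum (leg x)" "leg x \<subseteq> L" "v \<in> leg x" "x \<in> leg x"
proof -
  have "continuum (leg x) \<and> leg x \<subseteq> L \<and> v \<in> leg x \<and> x \<in> leg x"
  proof (cases "x = v")
    case True
    then show ?thesis using v_in_L by (simp add: continuum_def)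
  next
    case False
    then obtain g where "arc g" "path_image g = leg x" "leg x \<subseteq> L" "pathstart g = v" "pathfinish g = x"
      using leg_path assms by blast
    then show ?thesis
      by (metis continuum_def arc_imp_path compact_path_image connected_path_image
          path_image_nonempty pathfinish_in_path_image pathstart_in_path_image)
  qed
  then show "continuum (leg x)" "leg x \<subseteq> L" "v \<in> leg x" "x \<in> leg x" by auto
qed

text \<open>An initial piece of an arc from \<open>v\<close> is again an arc from \<open>v\<close>,
  and such arcs are unique. At \<open>t = 0\<close> the convention for the degenerate leg takes
  over.\<close>

lemma leg_initial:
  assumes "arc g" "path_image g \<subseteq> L" "pathstart g = v" "t \<in> {0..1}"
  shows "leg (g t) = g ` {0..t}"
proof (cases "t = 0")
  case True
  then show ?thesis using assms(3) by (simp add: pathstart_def)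
next
  case False
  then obtain k where k: "arc k" "pathstart k = g 0" "pathfinish k = g t"
      "path_image k = g ` closed_segment 0 t"
    using subarc[OF assms(1), of 0 t] assms(4) by auto
  moreover have "path_image k \<subseteq> L"
    using k(4) assms(2,4) by (auto simp: closed_segment_eq_real_ivl path_image_def)
  ultimately show ?thesis
    using leg_eq_path_image[of k] assms(3,4)
    by (simp add: pathstart_def closed_segment_eq_real_ivl)
qed

text \<open>The leg of \<open>y\<close> is a continuum containing both ends of the leg of
  \<open>x\<close>.\<close>

lemma leg_mono:
  assumes "y \<in> L" "x \<in> leg y"
  shows "leg x \<subseteq> leg y"
proof (cases "x = v")
  case True
  then show ?thesis using leg_props[OF assms(1)] by simp
next
  case False
  moreover have "x \<in> L" using assms leg_props(2) by blast
  ultimately obtain g where "arc g" "path_image g = leg x" "leg x \<subseteq> L" "pathstart g = v" "pathfinish g = x"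
    using leg_path by blast
  then show ?thesis
    using arc_subset_continuum[OF L_hu, of g "leg y"] leg_props[OF assms(1)] assms(2) by metis
qed

text \<open>If neither point lies on the leg of the other, the two legs part at some \<open>w\<close>; either
  \<open>w = v\<close>, and the continuum contains the arc through \<open>v\<close>, or \<open>w\<close> tops a triod.\<close>
lemma comparable_if_continuum_avoids_top:
  assumes T: "continuum T" "T \<subseteq> L" "v \<notin> T" and xy: "x \<in> T" "y \<in> T"
  shows "x \<in> leg y \<or> y \<in> leg x"
proof (rule ccontr)
  assume nc: "\<not> (x \<in> leg y \<or> y \<in> leg x)"
  have "x \<in> L" "y \<in> L" "x \<noteq> v" "y \<noteq> v" using assms by auto
  obtain g where g: "arc g" "path_image g = leg x" "leg x \<subseteq> L" "pathstart g = v" "pathfinish g = x"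
    using leg_path \<open>x \<in> L\<close> \<open>x \<noteq> v\<close> by blast
  obtain h where h: "arc h" "path_image h = leg y" "leg y \<subseteq> L" "pathstart h = v" "pathfinish h = y"
    using leg_path \<open>y \<in> L\<close> \<open>y \<noteq> v\<close> by blast
  define I where "I = leg x \<inter> leg y"
  have "compact I"
    using leg_props(1)[OF \<open>x \<in> L\<close>] leg_props(1)[OF \<open>y \<in> L\<close>]
    by (auto simp: I_def continuum_def compact_Int)
  have leg_I: "leg z \<subseteq> I" if "z \<in> I" for z
    using that leg_mono \<open>x \<in> L\<close> \<open>y \<in> L\<close> unfolding I_def by blast
  \<comment> \<open>With each point, \<open>I\<close> contains its whole leg. In the parameter of
    \<open>k\<close> it is therefore an initial interval; \<open>s\<close> is the largest parameter,
    attained by compactness, and differs from 1 because the end of \<open>k\<close> is not in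
    \<open>I\<close>.\<close>
  have last: "\<exists>s\<in>{0..<1}. I = k ` {0..s}"
    if k: "arc k" "path_image k \<subseteq> L" "pathstart k = v" "I \<subseteq> path_image k" "pathfinish k \<notin> I" for k
  proof -
    obtain j where j: "homeomorphism {0..1} (path_image k) k j"
      using homeomorphism_arc[OF k(1)] .
    have "v \<in> I" using leg_props \<open>x \<in> L\<close> \<open>y \<in> L\<close> by (auto simp: I_def)
    have "compact (j ` I)"
      using j k(4) \<open>compact I\<close>
      by (meson compact_continuous_image continuous_on_subset homeomorphism_def)
    then obtain s where s: "s \<in> j ` I" "\<And>t. t \<in> j ` I \<Longrightarrow> t \<le> s"
      using compact_attains_sup \<open>v \<in> I\<close> by (metis empty_iff image_is_empty)
    then obtain z where z: "z \<in> I" "s = j z" by auto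
    have kj: "k (j i) = i" "j i \<in> {0..1}" if "i \<in> I" for i
      using j k(4) that unfolding homeomorphism_def by blast+
    have "k ` {0..s} = leg z"
      using leg_initial[OF k(1,2,3), of s] kj[OF z(1)] z(2) by simp
    then have "k ` {0..s} \<subseteq> I" using leg_I z(1) by simp
    moreover have "I \<subseteq> k ` {0..s}"
    proof
      fix i assume "i \<in> I"
      then show "i \<in> k ` {0..s}" using kj[OF \<open>i \<in> I\<close>] s(2)[of "j i"] by (intro image_eqI[of _ _ "j i"]) auto
    qed
    moreover have "s \<noteq> 1"
      using kj[OF z(1)] z k(5) by (auto simp: pathfinish_def)
    ultimately show ?thesis using kj(2)[OF z(1)] z(2) by force
  qed
  have "x \<notin> I" "y \<notin> I" using nc by (auto simp: I_def)
  obtain s where s: "s \<in> {0..<1}" "I = g ` {0..s}"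
    using last[of g] g \<open>x \<notin> I\<close> by (auto simp: I_def)
  obtain t where t: "t \<in> {0..<1}" "I = h ` {0..t}"
    using last[of h] h \<open>y \<notin> I\<close> by (auto simp: I_def)
  have inj: "inj_on g {0..1}" "inj_on h {0..1}" using g(1) h(1) by (auto simp: arc_def)
  \<comment> \<open>Both \<open>g s\<close> and \<open>h t\<close> have \<open>I\<close> as their
    leg, and a point is determined by its leg: writing \<open>h t\<close> as \<open>g a\<close> with
    \<open>a\<close> at most \<open>s\<close>, injectivity of \<open>g\<close> forces
    \<open>a = s\<close>.\<close>
  have gh: "g s = h t"
  proof -
    have "leg (h t) = I" "leg (g s) = I"
      using leg_initial[of h t] leg_initial[of g s] g h s t by auto
    obtain a where a: "a \<in> {0..s}" "h t = g a"
      using t s by (metis atLeastAtMost_iff atLeastLessThan_iff image_iff order_refl)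
    have "leg (g a) = g ` {0..a}"
      using leg_initial[of g a] g a(1) s(1) by auto
    then have "g s \<in> g ` {0..a}"
      using \<open>leg (h t) = I\<close> a s by auto
    then obtain b where "b \<in> {0..a}" "g s = g b" by blast
    then have "s = b" using inj(1) a(1) s(1) by (auto simp: inj_on_def)
    then show ?thesis using a \<open>b \<in> {0..a}\<close> by auto
  qed
  show False
  proof (cases "g s = v")
    case True
    have "s = 0" using inj(1) True g(4) s(1) by (auto simp: inj_on_def pathstart_def)
    then have "I = {v}" using s(2) True by auto
    \<comment> \<open>The legs meet only in \<open>v\<close>, so going back along one and out along
      the other is an arc from \<open>x\<close> to \<open>y\<close>. The continuum \<open>T\<close>
      must contain it, and with it \<open>v\<close>.\<close>
    obtain g' where g': "arc g'" "pathstart g' = x" "pathfinish g' = v" "path_image g' = leg x"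
      using arc_reversepath[OF g(1)] g by (metis path_image_reversepath pathfinish_reversepath pathstart_reversepath)
    have "arc (g' +++ h)"
      using g' h \<open>I = {v}\<close> by (intro arc_join) (auto simp: I_def)
    moreover have "path_image (g' +++ h) = leg x \<union> leg y"
      using g' h by (simp add: path_image_join)
    ultimately have "leg x \<union> leg y \<subseteq> T"
      using arc_subset_continuum[OF L_hu, of "g' +++ h" T] T xy g g' h by auto
    then show False using T(3) leg_props(3)[OF \<open>x \<in> L\<close>] by blast
  next
    case False
    then have "s \<noteq> 0" using g(4) by (auto simp: pathstart_def)
    have seg: "closed_segment s 0 = {0..s}" "closed_segment s 1 = {s..1}" "closed_segment t 1 = {t..1}"
      using s(1) t(1) by (auto simp: closed_segment_eq_real_ivl)
    \<comment> \<open>Three arcs leave the parting point \<open>g s\<close>: back to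
      \<open>v\<close>, on to \<open>x\<close> and on to \<open>y\<close>. They form a triod whose
      top is not \<open>v\<close>.\<close>
    obtain k1 where k1: "arc k1" "pathstart k1 = g s" "path_image k1 = g ` {0..s}"
      by (rule subarc[OF g(1), of s 0]) (use s(1) \<open>s \<noteq> 0\<close> seg in auto)
    obtain k2 where k2: "arc k2" "pathstart k2 = g s" "path_image k2 = g ` {s..1}"
      by (rule subarc[OF g(1), of s 1]) (use s(1) seg in auto)
    obtain k3 where k3: "arc k3" "pathstart k3 = g s" "path_image k3 = h ` {t..1}"
      by (rule subarc[OF h(1), of t 1]) (use t(1) seg gh in auto)
    have 1: "g ` {0..s} \<inter> g ` {s..1} = {g s}"
      using s(1) inj(1) by (auto simp: inj_on_def) force
    have 2: "h ` {0..t} \<inter> h ` {t..1} = {h t}"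
      using t(1) inj(2) by (auto simp: inj_on_def) force
    have "g ` {s..1} \<subseteq> leg x" "h ` {t..1} \<subseteq> leg y"
      using s(1) t(1) g(2) h(2) by (auto simp: path_image_def)
    then have "g ` {s..1} \<inter> h ` {t..1} \<subseteq> g ` {0..s}" using s(2) I_def by blast
    then have 3: "g ` {s..1} \<inter> h ` {t..1} = {g s}"
      using 1 gh s(1) t(1) by auto
    have "simple_triod_top (path_image k1 \<union> path_image k2 \<union> path_image k3) (g s)"
      unfolding simple_triod_top_def
    proof (rule exI[of _ k1], rule exI[of _ k2], rule exI[of _ k3], intro conjI)
      show "path_image k1 \<inter> path_image k2 = {g s}" "path_image k2 \<inter> path_image k3 = {g s}"
        using k1(3) k2(3) k3(3) 1 3 by simp_all
      show "path_image k1 \<inter> path_image k3 = {g s}"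
        using k1(3) k3(3) 2 s(2) t(2) gh by simp
    qed (rule k1 k2 k3 refl)+
    moreover have "path_image k1 \<union> path_image k2 \<union> path_image k3 \<subseteq> L"
      using k1(3) k2(3) k3(3) \<open>g ` {s..1} \<subseteq> leg x\<close> \<open>h ` {t..1} \<subseteq> leg y\<close> g(3) h(3) s(2)
      unfolding I_def by blast
    ultimately show False
      using ram_eq False unfolding ramification_point_def by blast
  qed
qed

section \<open>Height along the legs\<close>

definition height :: "'a \<Rightarrow> real" where
  "height x = (SUP y\<in>leg x. dist v y)"

lemma bdd_leg:
  assumes "x \<in> L"
  shows "bdd_above (dist v ` leg x)"
proof -
  have "compact (dist v ` leg x)"
    using leg_props(1)[OF assms] unfolding continuum_def
    by (intro compact_continuous_image continuous_on_dist continuous_on_const continuous_on_id) simp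
  then show ?thesis
    by (intro bounded_imp_bdd_above compact_imp_bounded)
qed

text \<open>Monotonicity along legs is why the height is a supremum over the leg and not just the
  distance from \<open>v\<close>, which may oscillate along it.\<close>

lemma height_mono:
  assumes "y \<in> L" "x \<in> leg y"
  shows "height x \<le> height y"
proof -
  have "x \<in> L" using assms leg_props(2) by blast
  then show ?thesis
    unfolding height_def
    by (intro cSUP_subset_mono bdd_leg leg_mono assms order_refl) (use leg_props(4) in blast)
qed

lemma dist_le_height:
  assumes "x \<in> L"
  shows "dist v x \<le> height x"
  unfolding height_def using leg_props(4)[OF assms] bdd_leg[OF assms] by (rule cSUP_upper)

lemma height_pos:
  assumes "x \<in> L" "x \<noteq> v"
  shows "0 < height x"
  using assms(2) by (intro less_le_trans[OF _ dist_le_height[OF assms(1)]]) simp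

lemma height_v [simp]: "height v = 0"
  by (simp add: height_def)

text \<open>Smoothness makes the legs of a convergent sequence converge in the Hausdorff distance,
  and heights differ by at most that distance.\<close>

lemma continuous_on_height: "continuous_on L height"
proof -
  have "(height \<circ> s) \<longlonglongrightarrow> height x"
    if x: "x \<in> L" and s: "\<forall>n. s n \<in> L" "s \<longlonglongrightarrow> x" for s x
  proof -
    have lim: "(\<lambda>n. hausdorff_dist (leg (s n)) (leg x)) \<longlonglongrightarrow> 0"
      using smooth x s unfolding smooth_fan_def by blast
    have "\<bar>height (s n) - height x\<bar> \<le> hausdorff_dist (leg (s n)) (leg x)" for n
      using leg_props(1)[of "s n"] leg_props(1)[of x] x s(1)
      unfolding height_def continuum_def
      by (intro abs_sup_dist_diff_le_hausdorff_dist) auto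
    then have "(\<lambda>n. height (s n) - height x) \<longlonglongrightarrow> 0"
      by (intro Lim_null_comparison[OF _ lim] always_eventually allI) (simp only: real_norm_def)
    then show ?thesis
      unfolding o_def by (rule LIM_zero_cancel)
  qed
  then show ?thesis
    unfolding continuous_on_sequentially by blast
qed

text \<open>Take the piece of the leg of \<open>y\<close> from \<open>x\<close> on: \<open>x\<close>
  lies on the leg of each of its points, so the height there is at least that of
  \<open>x\<close>.\<close>

lemma comparable_connected_upper:
  assumes "y \<in> L" "x \<in> leg y"
  obtains S where "connected S" "S \<subseteq> L" "x \<in> S" "y \<in> S" "\<And>z. z \<in> S \<Longrightarrow> height x \<le> height z"
proof (cases "y = v")
  case True
  then show ?thesis using that[of "{v}"] assms by auto
next
  case False
  then obtain g where g: "arc g" "path_image g = leg y" "leg y \<subseteq> L" "pathstart g = v" "pathfinish g = y"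
    using leg_path assms by blast
  then obtain s where s: "s \<in> {0..1}" "x = g s"
    using assms(2) unfolding path_image_def by blast
  show ?thesis
  proof (rule that[of "g ` {s..1}"])
    show "connected (g ` {s..1})"
      using g(1) s(1) unfolding arc_def path_def
      by (intro connected_continuous_image) (auto intro: continuous_on_subset)
    show sub: "g ` {s..1} \<subseteq> L"
      using g(2,3) s(1) by (auto simp: path_image_def)
    show "x \<in> g ` {s..1}" using s by auto
    show "y \<in> g ` {s..1}" using s(1) g(5) by (auto simp: pathfinish_def)
    fix z assume z: "z \<in> g ` {s..1}"
    then obtain t where t: "t \<in> {s..1}" "z = g t" by blast
    have "leg z = g ` {0..t}" using leg_initial[of g t] g t s(1) by auto
    then have "x \<in> leg z" using s t by auto
    then show "height x \<le> height z" using height_mono z sub by blast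
  qed
qed

subsection \<open>Clopen partitions of a smooth fan without its top\<close>

text \<open>The continua range over all of \<open>L\<close> without \<open>v\<close>, not over one
  level set, so that the condition can be handed on to lower levels.\<close>

definition separated_off_top :: "'a set \<Rightarrow> 'a set \<Rightarrow> bool" where
  "separated_off_top P Q \<longleftrightarrow>
     (\<forall>T. continuum T \<and> T \<subseteq> L \<and> v \<notin> T \<longrightarrow> T \<inter> P = {} \<or> T \<inter> Q = {})"

definition upper :: "real \<Rightarrow> 'a set" where
  "upper c = {x \<in> L. c \<le> height x}"

lemma compact_upper: "compact (upper c)"
proof -
  have "closedin (top_of_set L) (L \<inter> height -` {c..})"
    using continuous_on_height by (intro continuous_closedin_preimage) auto
  moreover have "L \<inter> height -` {c..} = upper c"
    by (auto simp: upper_def)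
  ultimately show ?thesis
    using L_compact closedin_compact by metis
qed

text \<open>The cut wire fence theorem separates \<open>P\<close> and \<open>Q\<close> by a clopen
  partition of the compact set \<open>upper c\<close>. The partition inherits
  \<open>separated_off_top\<close>, which makes the extension repeatable.\<close>

lemma clopen_partition_upper:
  assumes c: "0 < c" and P: "compact P" "P \<subseteq> upper c" and Q: "compact Q" "Q \<subseteq> upper c"
    and sep: "separated_off_top P Q"
  obtains P' Q' where "compact P'" "compact Q'" "P \<subseteq> P'" "Q \<subseteq> Q'" "P' \<inter> Q' = {}"
    "P' \<union> Q' = upper c" "separated_off_top P' Q'"
proof -
  let ?X = "top_of_set (upper c)"
  have v: "v \<notin> upper c" using c by (simp add: upper_def)
  have cl: "closed (upper c)" by (simp add: compact_upper compact_imp_closed)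
  have "separated_between ?X P Q"
  proof (rule cut_wire_fence_theorem)
    show "compact_space ?X"
      by (simp add: compact_space_subtopology compact_upper)
    show "Hausdorff_space ?X"
      by (simp add: Hausdorff_space_subtopology)
    show "closedin ?X P" "closedin ?X Q"
      using P Q by (simp_all add: closed_subset compact_imp_closed)
    fix C assume "connectedin ?X C"
    then have C: "connected C" "C \<subseteq> upper c"
      by (auto simp: connectedin_subtopology)
    show "disjnt C P \<or> disjnt C Q"
    proof (cases "C = {}")
      case False
      \<comment> \<open>The set \<open>C\<close> is only connected; its closure is a continuum
        avoiding \<open>v\<close>, to which \<open>sep\<close> applies.\<close>
      have sub: "closure C \<subseteq> upper c" using C(2) cl by (simp add: closure_minimal)
      then have "compact (closure C)"
        using compact_upper by (metis closed_closure compact_Int_closed inf.absorb_iff2)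
      then have "continuum (closure C)"
        using False C(1) by (simp add: continuum_def connected_imp_connected_closure)
      moreover have "closure C \<subseteq> L" "v \<notin> closure C"
        using sub v by (auto simp: upper_def)
      ultimately have "closure C \<inter> P = {} \<or> closure C \<inter> Q = {}"
        using sep unfolding separated_off_top_def by blast
      then show ?thesis
        using closure_subset[of C] unfolding disjnt_def by blast
    qed simp
  qed
  then obtain P' Q' where PQ: "closedin ?X P'" "closedin ?X Q'" "P' \<union> Q' = upper c" "disjnt P' Q'"
      "P \<subseteq> P'" "Q \<subseteq> Q'"
    unfolding separated_between_alt by auto
  then have comp: "compact P'" "compact Q'"
    using compact_upper closedin_compact by blast+
  \<comment> \<open>The continuum \<open>T\<close> may dip below level \<open>c\<close>. But
    \<open>a\<close> and \<open>b\<close> are then comparable, and the piece of leg between them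
    joins them inside \<open>upper c\<close>, against the clopen partition.\<close>
  have "separated_off_top P' Q'"
    unfolding separated_off_top_def
  proof (intro allI impI, rule ccontr)
    fix T assume T: "continuum T \<and> T \<subseteq> L \<and> v \<notin> T"
      and "\<not> (T \<inter> P' = {} \<or> T \<inter> Q' = {})"
    then obtain a b where ab: "a \<in> T" "b \<in> T" "a \<in> P'" "b \<in> Q'" by blast
    then have up: "a \<in> upper c" "b \<in> upper c" using PQ(3) by auto
    have join: "\<exists>S. connected S \<and> x \<in> S \<and> y \<in> S \<and> S \<subseteq> upper c"
      if "x \<in> upper c" "y \<in> upper c" "x \<in> leg y" for x y
    proof -
      have "y \<in> L" using that(2) by (simp add: upper_def)
      from this that(3) obtain S where "connected S" "S \<subseteq> L" "x \<in> S" "y \<in> S"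
        "\<And>z. z \<in> S \<Longrightarrow> height x \<le> height z"
        by (rule comparable_connected_upper) blast
      then show ?thesis using that(1) by (force simp: upper_def)
    qed
    have "a \<in> leg b \<or> b \<in> leg a"
      using T ab by (intro comparable_if_continuum_avoids_top[of T]) auto
    then have "\<exists>S. connected S \<and> a \<in> S \<and> b \<in> S \<and> S \<subseteq> upper c"
      using join[of a b] join[of b a] up by blast
    then obtain S where S: "connected S" "a \<in> S" "b \<in> S" "S \<subseteq> upper c" by blast
    have "closed P'" "closed Q'" using comp by (auto simp: compact_imp_closed)
    then show False
      using S ab PQ(3,4) unfolding connected_closed disjnt_def by blast
  qed
  with that PQ comp show ?thesis by (metis disjnt_def)
qed

text \<open>The sets \<open>Y0\<close> and \<open>Y1\<close> may accumulate at \<open>v\<close>, so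
  no single level captures them. They are tied by continua off \<open>v\<close> to the seeds
  \<open>E0\<close> and \<open>E1\<close>, which do fit into one level; partitions of lower and
  lower levels are then chosen recursively, absorbing the new parts of \<open>Y0\<close> and
  \<open>Y1\<close> each time.\<close>

lemma clopen_partition_off_top:
  assumes Y: "compact Y0" "compact Y1" "Y0 \<subseteq> L" "Y1 \<subseteq> L"
    and E: "compact E0" "compact E1" "E0 \<subseteq> L" "E1 \<subseteq> L" "v \<notin> E0" "v \<notin> E1"
    and sep: "separated_off_top E0 E1"
    and Y0: "\<And>y. \<lbrakk>y \<in> Y0; y \<noteq> v\<rbrakk> \<Longrightarrow> \<exists>S. continuum S \<and> S \<subseteq> L \<and> v \<notin> S \<and> y \<in> S \<and> S \<inter> E0 \<noteq> {}"
    and Y1: "\<And>y. \<lbrakk>y \<in> Y1; y \<noteq> v\<rbrakk> \<Longrightarrow> \<exists>S. continuum S \<and> S \<subseteq> L \<and> v \<notin> S \<and> y \<in> S \<and> S \<inter> E1 \<noteq> {}"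
  obtains U V where "openin (top_of_set L) U" "openin (top_of_set L) V" "U \<union> V = L - {v}"
    "U \<inter> V = {}" "Y0 - {v} \<subseteq> U" "Y1 - {v} \<subseteq> V"
proof -
  \<comment> \<open>The height attains a positive minimum on the seeds; if there are none, any level
    will do.\<close>
  have "\<exists>d>0. E0 \<union> E1 \<subseteq> upper d"
  proof (cases "E0 \<union> E1 = {}")
    case False
    have "compact (E0 \<union> E1)" "continuous_on (E0 \<union> E1) height"
      using E continuous_on_height by (auto intro: continuous_on_subset)
    then obtain x where x: "x \<in> E0 \<union> E1" "\<forall>y\<in>E0 \<union> E1. height x \<le> height y"
      using continuous_attains_inf False by metis
    then have "0 < height x" using height_pos E by (metis Un_iff subsetD)
    then show ?thesis using x E by (intro exI[of _ "height x"]) (auto simp: upper_def)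
  qed (auto intro: exI[of _ 1])
  then obtain d where d: "0 < d" "E0 \<union> E1 \<subseteq> upper d" by blast
  define K where "K n = upper (d / real (Suc n))" for n
  have dn: "0 < d / real (Suc n)" "d / real (Suc (Suc n)) < d / real (Suc n)" for n
    using d(1) by (auto simp: field_simps)
  have v_K: "v \<notin> K n" for n using dn(1)[of n] by (simp add: K_def upper_def)
  have K_Suc: "K n \<subseteq> K (Suc n)" for n
    using dn(2)[of n] unfolding K_def upper_def by auto
  have E_K: "E0 \<union> E1 \<subseteq> K 0" using d(2) by (simp add: K_def)
  define good where "good n PQ \<longleftrightarrow> (case PQ of (P, Q) \<Rightarrow> compact P \<and> compact Q \<and> E0 \<subseteq> P \<and> E1 \<subseteq> Q \<and>
      separated_off_top P Q \<and> P \<inter> Q = {} \<and> P \<union> Q = K n \<and> Y0 \<inter> K n \<subseteq> P \<and> Y1 \<inter> K n \<subseteq> Q)"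
    for n and PQ :: "'a set \<times> 'a set"
  have step: "\<exists>PQ. good n PQ \<and> P \<subseteq> fst PQ \<and> Q \<subseteq> snd PQ"
    if P: "compact P" "E0 \<subseteq> P" "P \<subseteq> K n" and Q: "compact Q" "E1 \<subseteq> Q" "Q \<subseteq> K n"
      and s: "separated_off_top P Q" for n P Q
  proof -
    \<comment> \<open>A continuum meeting both enlarged sets can be lengthened at \<open>a\<close>
      and \<open>b\<close> by continua off \<open>v\<close> until it meets \<open>P\<close> and
      \<open>Q\<close> themselves; a singleton serves where nothing has to be added.\<close>
    have "separated_off_top (P \<union> (Y0 \<inter> K n)) (Q \<union> (Y1 \<inter> K n))"
      unfolding separated_off_top_def
    proof (intro allI impI, rule ccontr)
      fix T assume T: "continuum T \<and> T \<subseteq> L \<and> v \<notin> T"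
        and "\<not> (T \<inter> (P \<union> Y0 \<inter> K n) = {} \<or> T \<inter> (Q \<union> Y1 \<inter> K n) = {})"
      then obtain a b where ab: "a \<in> T" "b \<in> T" "a \<in> P \<or> a \<in> Y0" "b \<in> Q \<or> b \<in> Y1" by blast
      have "\<exists>S. continuum S \<and> S \<subseteq> L \<and> v \<notin> S \<and> a \<in> S \<and> S \<inter> P \<noteq> {}"
      proof (cases "a \<in> P")
        case True
        then show ?thesis using ab T by (intro exI[of _ "{a}"]) (auto simp: continuum_def)
      next
        case False
        then have "a \<in> Y0" "a \<noteq> v" using ab T by auto
        then show ?thesis using Y0[of a] P(2) by blast
      qed
      then obtain S where S: "continuum S" "S \<subseteq> L" "v \<notin> S" "a \<in> S" "S \<inter> P \<noteq> {}" by blast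
      have "\<exists>R. continuum R \<and> R \<subseteq> L \<and> v \<notin> R \<and> b \<in> R \<and> R \<inter> Q \<noteq> {}"
      proof (cases "b \<in> Q")
        case True
        then show ?thesis using ab T by (intro exI[of _ "{b}"]) (auto simp: continuum_def)
      next
        case False
        then have "b \<in> Y1" "b \<noteq> v" using ab T by auto
        then show ?thesis using Y1[of b] Q(2) by blast
      qed
      then obtain R where R: "continuum R" "R \<subseteq> L" "v \<notin> R" "b \<in> R" "R \<inter> Q \<noteq> {}" by blast
      have "continuum ((T \<union> S) \<union> R)"
        using T S R ab by (intro continuum_union) auto
      then show False
        using s T S R unfolding separated_off_top_def by blast
    qed
    moreover have "compact (P \<union> (Y0 \<inter> K n))" "compact (Q \<union> (Y1 \<inter> K n))"
      using P Q Y by (auto intro!: compact_Un compact_Int simp: K_def compact_upper)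
    ultimately obtain P' Q' where "compact P'" "compact Q'" "P \<union> (Y0 \<inter> K n) \<subseteq> P'"
        "Q \<union> (Y1 \<inter> K n) \<subseteq> Q'" "P' \<inter> Q' = {}" "P' \<union> Q' = K n" "separated_off_top P' Q'"
      using clopen_partition_upper[OF dn(1)[of n], of "P \<union> (Y0 \<inter> K n)" "Q \<union> (Y1 \<inter> K n)"] P(3) Q(3)
      unfolding K_def by auto
    then show ?thesis
      using P(2) Q(2) by (intro exI[of _ "(P', Q')"]) (auto simp: good_def)
  qed
  have "\<exists>PQ. \<forall>n. good n (PQ n) \<and> (fst (PQ n) \<subseteq> fst (PQ (Suc n)) \<and> snd (PQ n) \<subseteq> snd (PQ (Suc n)))"
  proof (rule dependent_nat_choice)
    show "\<exists>PQ. good 0 PQ" using step[of E0 0 E1] E E_K sep by auto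
    fix PQ n assume good: "good n PQ"
    then have "fst PQ \<subseteq> K (Suc n)" "snd PQ \<subseteq> K (Suc n)"
      using K_Suc[of n] by (auto simp: good_def)
    with good show "\<exists>PQ'. good (Suc n) PQ' \<and> fst PQ \<subseteq> fst PQ' \<and> snd PQ \<subseteq> snd PQ'"
      using step[of "fst PQ" "Suc n" "snd PQ"] by (simp add: good_def[of n] split_beta)
  qed
  then obtain PQ where PQ: "\<And>n. good n (PQ n)"
    and mono: "\<And>n. fst (PQ n) \<subseteq> fst (PQ (Suc n))" "\<And>n. snd (PQ n) \<subseteq> snd (PQ (Suc n))"
    by blast
  define P Q where "P n = fst (PQ n)" and "Q n = snd (PQ n)" for n
  have g: "compact (P n)" "compact (Q n)" "P n \<inter> Q n = {}" "P n \<union> Q n = K n"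
    "Y0 \<inter> K n \<subseteq> P n" "Y1 \<inter> K n \<subseteq> Q n" for n
    using PQ[of n] by (auto simp: good_def P_def Q_def split: prod.splits)
  have mono_P: "P n \<subseteq> P m" and mono_Q: "Q n \<subseteq> Q m" if "n \<le> m" for n m
    using lift_Suc_mono_le[of P, OF _ that] lift_Suc_mono_le[of Q, OF _ that] mono
    by (simp_all add: P_def Q_def)
  \<comment> \<open>These relatively open sets interleave with the compact levels:
    \<open>W n\<close> lies in \<open>K n\<close>, and \<open>K n\<close> in
    \<open>W (Suc n)\<close>.\<close>
  define W where "W n = {x \<in> L. d / real (Suc n) < height x}" for n
  have W_open: "openin (top_of_set L) (W n)" for n
  proof -
    have "openin (top_of_set L) (L \<inter> height -` {d / real (Suc n)<..})"
      using continuous_on_height by (intro continuous_openin_preimage_gen) auto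
    moreover have "L \<inter> height -` {d / real (Suc n)<..} = W n" by (auto simp: W_def)
    ultimately show ?thesis by simp
  qed
  have W_K: "W n \<subseteq> K n" "K n \<subseteq> W (Suc n)" for n
    using dn(2)[of n] by (auto simp: W_def K_def upper_def)
  have K_L: "K n \<subseteq> L" for n by (auto simp: K_def upper_def)
  have opn: "openin (top_of_set L) (W n - A)" if "compact A" for n A
  proof -
    have "W n - A = W n \<inter> (L - L \<inter> A)" by (auto simp: W_def)
    moreover have "openin (top_of_set L) (L - L \<inter> A)"
      using that by (metis Diff_Int2 closedin_closed_Int compact_imp_closed inf.idem openin_diff openin_subtopology_self)
    ultimately show ?thesis using W_open by (simp add: openin_Int)
  qed
  \<comment> \<open>Rewriting the increasing union of the closed sets \<open>P n\<close> as a union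
    of the sets \<open>W n - Q n\<close> shows that it is relatively open.\<close>
  have PU: "(\<Union>n. P n) = (\<Union>n. W n - Q n)"
  proof (intro subset_antisym UN_least)
    fix n
    have "P n \<subseteq> W (Suc n) - Q (Suc n)"
      using g(4)[of n] g(3)[of "Suc n"] W_K(2)[of n] mono_P[of n "Suc n"] by auto
    then show "P n \<subseteq> (\<Union>n. W n - Q n)" by blast
    show "W n - Q n \<subseteq> (\<Union>n. P n)"
      using g(4)[of n] W_K(1)[of n] by blast
  qed
  have QU: "(\<Union>n. Q n) = (\<Union>n. W n - P n)"
  proof (intro subset_antisym UN_least)
    fix n
    have "Q n \<subseteq> W (Suc n) - P (Suc n)"
      using g(4)[of n] g(3)[of "Suc n"] W_K(2)[of n] mono_Q[of n "Suc n"] by auto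
    then show "Q n \<subseteq> (\<Union>n. W n - P n)" by blast
    show "W n - P n \<subseteq> (\<Union>n. Q n)"
      using g(4)[of n] W_K(1)[of n] by blast
  qed
  have cover: "\<exists>n. x \<in> K n" if "x \<in> L" "x \<noteq> v" for x
  proof -
    have "0 < height x / d" using height_pos[OF that] d(1) by simp
    then obtain n where "inverse (real (Suc n)) < height x / d"
      using reals_Archimedean by blast
    then have "d / real (Suc n) \<le> height x" using d(1) by (simp add: field_simps)
    then show ?thesis using that(1) by (auto simp: K_def upper_def)
  qed
  show ?thesis
  proof (rule that[of "\<Union>n. P n" "\<Union>n. Q n"])
    show "openin (top_of_set L) (\<Union>n. P n)"
      unfolding PU using opn g(2) by blast
    show "openin (top_of_set L) (\<Union>n. Q n)"
      unfolding QU using opn g(1) by blast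
    show "(\<Union>n. P n) \<union> (\<Union>n. Q n) = L - {v}"
    proof -
      have "(\<Union>n. P n) \<union> (\<Union>n. Q n) = (\<Union>n. K n)" using g(4) by blast
      also have "\<dots> = L - {v}"
      proof (intro subset_antisym UN_least subsetI)
        fix x assume "x \<in> L - {v}"
        then show "x \<in> (\<Union>n. K n)" using cover[of x] by blast
      qed (use v_K K_L in blast)
      finally show ?thesis .
    qed
    show "(\<Union>n. P n) \<inter> (\<Union>n. Q n) = {}"
    proof -
      have "P n \<inter> Q m = {}" for n m
        using g(3)[of "max n m"] mono_P[of n "max n m"] mono_Q[of m "max n m"] by auto
      then show ?thesis by blast
    qed
    show "Y0 - {v} \<subseteq> (\<Union>n. P n)"
    proof
      fix y assume "y \<in> Y0 - {v}"
      moreover from this obtain n where "y \<in> K n" using cover[of y] Y(3) by blast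
      ultimately show "y \<in> (\<Union>n. P n)" using g(5)[of n] by blast
    qed
    show "Y1 - {v} \<subseteq> (\<Union>n. Q n)"
    proof
      fix y assume "y \<in> Y1 - {v}"
      moreover from this obtain n where "y \<in> K n" using cover[of y] Y(4) by blast
      ultimately show "y \<in> (\<Union>n. Q n)" using g(6)[of n] by blast
    qed
  qed
qed

end

subsection \<open>Ternary digits and the Cantor fan\<close>

definition ternary :: "(nat \<Rightarrow> nat) \<Rightarrow> real" where
  "ternary d = (\<Sum>n. real (d n) / 3 ^ Suc n)"

definition cantor_digits :: "(nat \<Rightarrow> nat) set" where
  "cantor_digits = {d. \<forall>n. d n \<in> {0, 2}}"

lemma cantor_set_eq: "cantor_set = ternary ` cantor_digits"
  unfolding cantor_set_def ternary_def cantor_digits_def by blast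

lemma ternary_tail_sums: "(\<lambda>k. 2 / 3 ^ Suc (k + n)) sums (1 / 3 ^ n :: real)"
proof -
  have "(\<lambda>k. (2 / 3 ^ Suc n) * (1 / 3) ^ k) sums ((2 / 3 ^ Suc n) * (1 / (1 - 1 / 3)) :: real)"
    by (intro sums_mult geometric_sums) simp
  then show ?thesis by (simp add: power_add power_one_over field_simps)
qed

lemma cantor_digits_le: "d \<in> cantor_digits \<Longrightarrow> d n \<le> 2"
  by (auto simp: cantor_digits_def dest!: spec[of _ n])

lemma ternary_term_le: "d \<in> cantor_digits \<Longrightarrow> real (d n) / 3 ^ Suc n \<le> 2 / 3 ^ Suc n"
  using cantor_digits_le[of d n] by (intro divide_right_mono) auto

lemma summable_ternary:
  assumes "d \<in> cantor_digits"
  shows "summable (\<lambda>n. real (d n) / 3 ^ Suc n)"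
proof (rule summable_comparison_test')
  show "summable (\<lambda>n. 2 / 3 ^ Suc n :: real)"
    using sums_summable[OF ternary_tail_sums[of 0]] by (simp only: add_0_right)
  show "norm (real (d n) / 3 ^ Suc n) \<le> 2 / 3 ^ Suc n" if "0 \<le> n" for n
    using ternary_term_le[OF assms, of n] by (simp only: real_norm_def abs_of_nonneg)
      (simp only: abs_divide abs_of_nat power_abs abs_numeral)
qed

text \<open>The remainder after \<open>n\<close> digits is compared with the geometric tail in which
  every digit is 2.\<close>

lemma ternary_split:
  assumes "d \<in> cantor_digits"
  obtains e where "ternary d = (\<Sum>k<n. real (d k) / 3 ^ Suc k) + e" "0 \<le> e" "e \<le> 1 / 3 ^ n"
proof
  let ?e = "\<Sum>k. real (d (k + n)) / 3 ^ Suc (k + n)"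
  have sm: "summable (\<lambda>k. real (d (k + n)) / 3 ^ Suc (k + n))"
    using summable_ternary[OF assms] summable_iff_shift[of "\<lambda>k. real (d k) / 3 ^ Suc k" n] by simp
  show "ternary d = (\<Sum>k<n. real (d k) / 3 ^ Suc k) + ?e"
    unfolding ternary_def
    using suminf_split_initial_segment[OF summable_ternary[OF assms], of n] by simp
  show "0 \<le> ?e" by (rule suminf_nonneg[OF sm]) simp
  have "?e \<le> (\<Sum>k. 2 / 3 ^ Suc (k + n))"
    using ternary_term_le[OF assms] sm sums_summable[OF ternary_tail_sums]
    by (intro suminf_le) auto
  then show "?e \<le> 1 / 3 ^ n"
    using sums_unique[OF ternary_tail_sums[of n]] by simp
qed

text \<open>The first differing digit gains \<open>2 / 3 ^ Suc n\<close>, while the remaining digits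
  of \<open>d\<close> contribute at most half of that.\<close>

lemma ternary_less:
  assumes "d \<in> cantor_digits" "d' \<in> cantor_digits" "\<And>k. k < n \<Longrightarrow> d k = d' k" "d n = 0" "d' n = 2"
  shows "ternary d < ternary d'"
proof -
  obtain e where e: "ternary d = (\<Sum>k<Suc n. real (d k) / 3 ^ Suc k) + e" "0 \<le> e" "e \<le> 1 / 3 ^ Suc n"
    using ternary_split[OF assms(1)] .
  obtain e' where e': "ternary d' = (\<Sum>k<Suc n. real (d' k) / 3 ^ Suc k) + e'" "0 \<le> e'" "e' \<le> 1 / 3 ^ Suc n"
    using ternary_split[OF assms(2)] .
  have "(\<Sum>k<n. real (d k) / 3 ^ Suc k) = (\<Sum>k<n. real (d' k) / 3 ^ Suc k)"
    using assms(3) by (intro sum.cong) auto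
  moreover have "(1::real) / 3 ^ Suc n < 2 / 3 ^ Suc n"
    by (intro divide_strict_right_mono) auto
  ultimately show ?thesis
    using e e' assms(4,5) unfolding sum.lessThan_Suc by (simp del: power_Suc)
qed

lemma inj_on_ternary: "inj_on ternary cantor_digits"
proof (rule inj_onI, rule ccontr)
  fix d d' assume d: "d \<in> cantor_digits" "d' \<in> cantor_digits" "ternary d = ternary d'" "d \<noteq> d'"
  define n where "n = (LEAST n. d n \<noteq> d' n)"
  have "\<exists>n. d n \<noteq> d' n" using d(4) by auto
  then have "d n \<noteq> d' n"
    unfolding n_def by (rule LeastI_ex)
  moreover have "d k = d' k" if "k < n" for k
    using not_less_Least[OF that[unfolded n_def]] by simp
  ultimately have n: "d n \<noteq> d' n" "\<And>k. k < n \<Longrightarrow> d k = d' k" by blast+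
  have "d n \<in> {0, 2}" "d' n \<in> {0, 2}" using d(1,2) by (auto simp: cantor_digits_def)
  then show False
    using n ternary_less[of d d' n] ternary_less[of d' d n] d by force
qed

lemma cantor_set_subset: "cantor_set \<subseteq> {0..1}"
proof
  fix x assume "x \<in> cantor_set"
  then obtain d where d: "d \<in> cantor_digits" "x = ternary d" by (auto simp: cantor_set_eq)
  obtain e where "ternary d = (\<Sum>k<0. real (d k) / 3 ^ Suc k) + e" "0 \<le> e" "e \<le> 1 / 3 ^ 0"
    using ternary_split[OF d(1)] .
  then show "x \<in> {0..1}" using d(2) by simp
qed

text \<open>The Weierstrass test gives uniform convergence, so a map into the Cantor set may be
  built and checked digit by digit.\<close>

lemma continuous_on_ternary:
  assumes "\<And>x. x \<in> S \<Longrightarrow> D x \<in> cantor_digits" "\<And>n. continuous_on S (\<lambda>x. real (D x n))"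
  shows "continuous_on S (\<lambda>x. ternary (D x))"
  unfolding ternary_def
proof (rule uniform_limit_theorem)
  show "uniform_limit S (\<lambda>m x. \<Sum>n<m. real (D x n) / 3 ^ Suc n) (\<lambda>x. \<Sum>n. real (D x n) / 3 ^ Suc n) sequentially"
    using ternary_term_le[OF assms(1)] sums_summable[OF ternary_tail_sums[of 0]]
    by (intro Weierstrass_m_test[where M = "\<lambda>n. 2 / 3 ^ Suc n"]) auto
  show "\<forall>\<^sub>F m in sequentially. continuous_on S (\<lambda>x. \<Sum>n<m. real (D x n) / 3 ^ Suc n)"
    using assms(2) by (intro always_eventually allI continuous_on_sum continuous_on_divide
        continuous_on_const) auto
qed simp

text \<open>By Tychonoff the digit sequences form a compact product, also with one digit restricted.
  \<open>A = UNIV\<close> gives the whole Cantor set, a singleton the two pieces to be separated for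
  digit \<open>j\<close>.\<close>

lemma compact_ternary_image_digit:
  "compact (ternary ` {d \<in> cantor_digits. d j \<in> A})"
proof (rule compact_continuous_image)
  let ?B = "\<lambda>i. {0, 2} \<inter> (if i = j then A else UNIV)"
  have "compactin (product_topology (\<lambda>i::nat. euclidean :: nat topology) UNIV) (PiE UNIV ?B)"
    by (subst compactin_PiE) (auto intro: finite_imp_compact)
  moreover have "PiE UNIV ?B = {d \<in> cantor_digits. d j \<in> A}"
    by (auto simp: PiE_def Pi_def cantor_digits_def split: if_splits)
  ultimately show "compact {d \<in> cantor_digits. d j \<in> A}"
    by (simp add: euclidean_product_topology)
  have "continuous_on X (\<lambda>d. real (d n))" for n and X :: "(nat \<Rightarrow> nat) set"
    using continuous_on_subset[OF continuous_on_product_coordinates[of n] subset_UNIV[of X]]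
    by (rule continuous_on_of_nat)
  then show "continuous_on {d \<in> cantor_digits. d j \<in> A} ternary"
    using continuous_on_ternary[of "{d \<in> cantor_digits. d j \<in> A}" "\<lambda>d. d"] by auto
qed

lemma compact_cantor_set: "compact cantor_set"
  using compact_ternary_image_digit[of 0 UNIV] by (simp add: cantor_set_eq)

section \<open>Cone coordinates on the standard Cantor fan\<close>

definition cone_point :: "real \<Rightarrow> real \<Rightarrow> real \<times> real" where
  "cone_point c t = ((1 - t) / 2 + t * c, t)"

lemma snd_cone_point [simp]: "snd (cone_point c t) = t"
  by (simp add: cone_point_def)

lemma cone_point_0 [simp]: "cone_point c 0 = (1/2, 0)"
  by (simp add: cone_point_def)

lemma UN_image_eq_image_Times: "(\<Union>a\<in>A. f a ` B) = (\<lambda>z. f (fst z) (snd z)) ` (A \<times> B)"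
  by force

lemma standard_cantor_fan_eq:
  "standard_cantor_fan = (\<lambda>z. cone_point (fst z) (snd z)) ` (cantor_set \<times> {0..1})"
proof -
  have "closed_segment (1/2, 0) (c, 1) = cone_point c ` {0..1}" for c :: real
    by (force simp: closed_segment_def cone_point_def image_iff)
  then have "standard_cantor_fan = (\<Union>c\<in>cantor_set. cone_point c ` {0..1})"
    by (simp add: standard_cantor_fan_def)
  also have "\<dots> = (\<lambda>z. cone_point (fst z) (snd z)) ` (cantor_set \<times> {0..1})"
    by (rule UN_image_eq_image_Times)
  finally show ?thesis .
qed

lemma cone_point_in [simp]:
  "\<lbrakk>c \<in> cantor_set; 0 \<le> t; t \<le> 1\<rbrakk> \<Longrightarrow> cone_point c t \<in> standard_cantor_fan"
  unfolding standard_cantor_fan_eq by (rule image_eqI[of _ _ "(c, t)"]) auto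

lemma cone_point_inj: "\<lbrakk>cone_point c t = cone_point c' t'; t \<noteq> 0\<rbrakk> \<Longrightarrow> c = c' \<and> t = t'"
  by (auto simp: cone_point_def)

lemma continuous_on_cone_point:
  "\<lbrakk>continuous_on S a; continuous_on S b\<rbrakk> \<Longrightarrow> continuous_on S (\<lambda>x. cone_point (a x) (b x))"
  unfolding cone_point_def by (intro continuous_intros) auto

lemma compact_standard_cantor_fan: "compact standard_cantor_fan"
  unfolding standard_cantor_fan_eq
  by (intro compact_continuous_image continuous_on_cone_point compact_Times compact_cantor_set
      continuous_on_fst continuous_on_snd continuous_on_id compact_Icc)

subsection \<open>Retractions onto Cantor fans\<close>

locale cantor_fan_in_smooth_fan = smooth_fan_space L v
  for L :: "'a::metric_space set" and v +
  fixes Y :: "'a set" and F :: "real \<times> real \<Rightarrow> 'a" and G :: "'a \<Rightarrow> real \<times> real"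
  assumes hom: "homeomorphism standard_cantor_fan Y F G" and Y_L: "Y \<subseteq> L"
begin

definition p :: "real \<Rightarrow> real \<Rightarrow> 'a" where
  "p c t = F (cone_point c t)"

lemma p_in: "\<lbrakk>c \<in> cantor_set; t \<in> {0..1}\<rbrakk> \<Longrightarrow> p c t \<in> Y"
  using hom unfolding p_def homeomorphism_def by force

lemma Y_cases:
  assumes "y \<in> Y"
  obtains c t where "c \<in> cantor_set" "t \<in> {0..1}" "y = p c t"
proof -
  have "y \<in> F ` standard_cantor_fan" using assms hom by (auto simp: homeomorphism_def)
  then show ?thesis using that by (auto simp: standard_cantor_fan_eq p_def)
qed

lemma p_inj:
  assumes "p c t = p c' t'" "c \<in> cantor_set" "c' \<in> cantor_set" "t \<in> {0..1}" "t' \<in> {0..1}" "t \<noteq> 0"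
  shows "c = c'" "t = t'"
proof -
  have "G (p c t) = G (p c' t')" using assms(1) by simp
  then have "cone_point c t = cone_point c' t'"
    using assms(2-5) hom by (simp add: p_def homeomorphism_def)
  then show "c = c'" "t = t'" using cone_point_inj assms(6) by blast+
qed

lemma p_0: "p c 0 = F (1/2, 0)"
  by (simp add: p_def)

lemma continuous_on_F: "continuous_on standard_cantor_fan F"
  using hom by (simp add: homeomorphism_def)

lemma continuous_on_p:
  assumes "continuous_on S a" "continuous_on S b" "a ` S \<subseteq> cantor_set" "b ` S \<subseteq> {0..1}"
  shows "continuous_on S (\<lambda>x. p (a x) (b x))"
  unfolding p_def
proof (rule continuous_on_compose2[OF continuous_on_F continuous_on_cone_point[OF assms(1,2)]])
  show "(\<lambda>x. cone_point (a x) (b x)) ` S \<subseteq> standard_cantor_fan"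
    using assms(3,4) by (force simp: image_subset_iff)
qed

lemma arc_p:
  assumes "c \<in> cantor_set"
  shows "arc (p c)" "path_image (p c) \<subseteq> L" "pathstart (p c) = F (1/2, 0)" "pathfinish (p c) = p c 1"
proof -
  have "continuous_on {0..1} (p c)"
    using continuous_on_p[of "{0..1}" "\<lambda>_. c" "\<lambda>t. t"] assms by auto
  moreover have "inj_on (p c) {0..1}"
  proof (rule inj_onI)
    fix s t assume "s \<in> {0..1}" "t \<in> {0..1}" "p c s = p c t"
    then show "s = t"
      using p_inj[of c s c t] p_inj[of c t c s] assms by metis
  qed
  ultimately show "arc (p c)" by (simp add: arc_def path_def)
  show "path_image (p c) \<subseteq> L" using p_in[OF assms] Y_L by (auto simp: path_image_def)
qed (simp_all add: pathstart_def pathfinish_def p_0)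

lemma path_images_p_Int:
  assumes "c \<in> cantor_set" "c' \<in> cantor_set" "c \<noteq> c'"
  shows "path_image (p c) \<inter> path_image (p c') = {F (1/2, 0)}"
proof (intro equalityI subsetI)
  fix y assume "y \<in> path_image (p c) \<inter> path_image (p c')"
  then obtain s t where st: "s \<in> {0..1}" "t \<in> {0..1}" "y = p c s" "y = p c' t"
    by (auto simp: path_image_def)
  then have "s = 0" using p_inj(1)[of c s c' t] assms by metis
  then show "y \<in> {F (1/2, 0)}" using st p_0 by simp
next
  fix y assume "y \<in> {F (1/2, 0)}"
  then show "y \<in> path_image (p c) \<inter> path_image (p c')"
    using arc_p(3)[of c] arc_p(3)[of c'] assms by (metis IntI pathstart_in_path_image singletonD)
qed

text \<open>Three legs of the embedded fan form a triod in \<open>L\<close>, whose only ramification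
  point is \<open>v\<close>.\<close>

lemma top_eq: "F (1/2, 0) = v"
proof -
  \<comment> \<open>Sequences with a single digit 2, at place \<open>i\<close>, supply distinct
    points of the Cantor set.\<close>
  define d :: "nat \<Rightarrow> nat \<Rightarrow> nat" where "d i n = (if n = i then 2 else 0)" for i n
  have d: "d i \<in> cantor_digits" for i by (auto simp: d_def cantor_digits_def)
  define c where "c i = ternary (d i)" for i
  have c: "c i \<in> cantor_set" for i using d by (simp add: c_def cantor_set_eq)
  have ne: "c i \<noteq> c j" if "i \<noteq> j" for i j
  proof
    assume "c i = c j"
    then have "d i = d j" using d inj_on_ternary unfolding c_def by (meson inj_onD)
    then have "d i i = d j i" by simp
    then show False using that by (simp add: d_def)
  qed
  have "simple_triod_top (path_image (p (c 0)) \<union> path_image (p (c 1)) \<union> path_image (p (c 2))) (F (1/2, 0))"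
    unfolding simple_triod_top_def
    by (rule exI[of _ "p (c 0)"], rule exI[of _ "p (c 1)"], rule exI[of _ "p (c 2)"], intro conjI)
       (rule arc_p path_images_p_Int c ne refl | simp)+
  moreover have "path_image (p (c 0)) \<union> path_image (p (c 1)) \<union> path_image (p (c 2)) \<subseteq> L"
    using arc_p(2)[OF c] by blast
  ultimately show ?thesis
    using ram_eq unfolding ramification_point_def by blast
qed

lemma p_eq_v_iff:
  assumes "c \<in> cantor_set" "t \<in> {0..1}"
  shows "p c t = v \<longleftrightarrow> t = 0"
  using p_inj(2)[of c t c 0] p_0[of c] top_eq assms by auto

text \<open>A continuum containing the ends of two different legs contains the arc between them,
  which passes through \<open>v\<close>.\<close>

lemma separated_off_top_ends:
  assumes "C0 \<subseteq> cantor_set" "C1 \<subseteq> cantor_set" "C0 \<inter> C1 = {}"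
  shows "separated_off_top ((\<lambda>c. p c 1) ` C0) ((\<lambda>c. p c 1) ` C1)"
  unfolding separated_off_top_def
proof (intro allI impI, rule ccontr)
  fix T assume T: "continuum T \<and> T \<subseteq> L \<and> v \<notin> T"
    and "\<not> (T \<inter> (\<lambda>c. p c 1) ` C0 = {} \<or> T \<inter> (\<lambda>c. p c 1) ` C1 = {})"
  then obtain c c' where c: "c \<in> C0" "c' \<in> C1" "p c 1 \<in> T" "p c' 1 \<in> T" by blast
  then have cc: "c \<in> cantor_set" "c' \<in> cantor_set" "c \<noteq> c'" using assms by auto
  let ?g = "reversepath (p c) +++ p c'"
  have start: "pathstart (p c) = v" "pathstart (p c') = v"
    using arc_p(3) cc(1,2) top_eq by auto
  have arc: "arc ?g"
    using start path_images_p_Int[OF cc] top_eq cc(1,2)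
    by (intro arc_join arc_reversepath arc_p(1)) auto
  have im: "path_image ?g = path_image (p c) \<union> path_image (p c')"
    using start by (simp add: path_image_join)
  have sub: "path_image ?g \<subseteq> L"
    unfolding im using arc_p(2) cc(1,2) by simp
  have ends: "pathstart ?g \<in> T" "pathfinish ?g \<in> T"
    using c(3,4) arc_p(4) cc(1,2) by simp_all
  have "path_image ?g \<subseteq> T"
    by (rule arc_subset_continuum[OF L_hu arc sub _ _ ends]) (use T in blast)+
  then show False
    using T im start(1) pathstart_in_path_image[of "p c"] by auto
qed

text \<open>The leg ends serve as seeds: they are compact sets off \<open>v\<close>, whereas the
  legs themselves reach \<open>v\<close>.\<close>

lemma clopen_extension:
  assumes C: "compact C0" "compact C1" "C0 \<subseteq> cantor_set" "C1 \<subseteq> cantor_set" "C0 \<inter> C1 = {}"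
  shows "\<exists>U V. openin (top_of_set L) U \<and> openin (top_of_set L) V \<and> U \<union> V = L - {v} \<and> U \<inter> V = {} \<and>
    (\<forall>c\<in>C0. \<forall>t\<in>{0<..1}. p c t \<in> U) \<and> (\<forall>c\<in>C1. \<forall>t\<in>{0<..1}. p c t \<in> V)"
proof -
  let ?E = "\<lambda>C. (\<lambda>c. p c 1) ` C" and ?Y = "\<lambda>C. (\<lambda>z. p (fst z) (snd z)) ` (C \<times> {0..1})"
  have cE: "compact (?E C)" "?E C \<subseteq> L" "v \<notin> ?E C" and cY: "compact (?Y C)" "?Y C \<subseteq> L"
    if "compact C" "C \<subseteq> cantor_set" for C
  proof -
    show "compact (?E C)"
      using that by (intro compact_continuous_image continuous_on_p continuous_on_const continuous_on_id) auto
    show "compact (?Y C)"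
      using that by (intro compact_continuous_image continuous_on_p compact_Times
          continuous_on_fst continuous_on_snd continuous_on_id) auto
    show "?E C \<subseteq> L" "?Y C \<subseteq> L"
      using that(2) p_in Y_L by (auto simp: subset_iff)
    show "v \<notin> ?E C"
    proof
      assume "v \<in> ?E C"
      then obtain c where "c \<in> C" "p c 1 = v" by auto
      then show False using p_eq_v_iff[of c 1] that(2) by auto
    qed
  qed
  \<comment> \<open>The outer piece of the leg, from \<open>y\<close> to its end, is a continuum off
    \<open>v\<close> that reaches the seed.\<close>
  have up: "\<exists>S. continuum S \<and> S \<subseteq> L \<and> v \<notin> S \<and> y \<in> S \<and> S \<inter> ?E C \<noteq> {}"
    if C: "C \<subseteq> cantor_set" and y: "y \<in> ?Y C" "y \<noteq> v" for C y
  proof -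
    obtain c t where ct: "c \<in> C" "t \<in> {0..1}" "y = p c t" using y(1) by auto
    then have c: "c \<in> cantor_set" using C by blast
    have t: "t \<noteq> 0" using p_eq_v_iff[OF c ct(2)] ct(3) y(2) by blast
    have cont: "continuous_on {t..1} (p c)"
      using continuous_on_p[of "{t..1}" "\<lambda>_. c" "\<lambda>t. t"] c ct(2) by auto
    have "continuum (p c ` {t..1})"
      using ct(2) compact_continuous_image[OF cont] connected_continuous_image[OF cont]
      by (auto simp: continuum_def)
    moreover have "p c ` {t..1} \<subseteq> L" using p_in[OF c] Y_L ct(2) by force
    moreover have "v \<notin> p c ` {t..1}"
    proof
      assume "v \<in> p c ` {t..1}"
      then obtain s where "s \<in> {t..1}" "p c s = v" by auto
      then show False using p_eq_v_iff[OF c, of s] t ct(2) by auto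
    qed
    moreover have "y \<in> p c ` {t..1}" using ct by auto
    moreover have "p c 1 \<in> p c ` {t..1} \<inter> ?E C" using ct(1,2) by auto
    then have "p c ` {t..1} \<inter> ?E C \<noteq> {}" by blast
    ultimately show ?thesis by (intro exI[of _ "p c ` {t..1}"] conjI)
  qed
  have "\<exists>U V. openin (top_of_set L) U \<and> openin (top_of_set L) V \<and> U \<union> V = L - {v} \<and> U \<inter> V = {} \<and>
      ?Y C0 - {v} \<subseteq> U \<and> ?Y C1 - {v} \<subseteq> V"
    by (rule clopen_partition_off_top[OF cY(1)[OF C(1,3)] cY(1)[OF C(2,4)] cY(2)[OF C(1,3)] cY(2)[OF C(2,4)]
          cE(1)[OF C(1,3)] cE(1)[OF C(2,4)] cE(2)[OF C(1,3)] cE(2)[OF C(2,4)] cE(3)[OF C(1,3)] cE(3)[OF C(2,4)]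
          separated_off_top_ends[OF C(3-5)] up[OF C(3)] up[OF C(4)]]) blast+
  then obtain U V where UV: "openin (top_of_set L) U" "openin (top_of_set L) V" "U \<union> V = L - {v}" "U \<inter> V = {}"
      "?Y C0 - {v} \<subseteq> U" "?Y C1 - {v} \<subseteq> V"
    by blast
  have mem: "p c t \<in> ?Y C - {v}" if "C \<subseteq> cantor_set" "c \<in> C" "t \<in> {0<..1}" for C c t
  proof -
    have "p c t \<in> ?Y C" using that by (intro image_eqI[of _ _ "(c, t)"]) auto
    moreover have "p c t \<noteq> v" using p_eq_v_iff[of c t] that by auto
    ultimately show ?thesis by blast
  qed
  have "\<forall>c\<in>C0. \<forall>t\<in>{0<..1}. p c t \<in> U" "\<forall>c\<in>C1. \<forall>t\<in>{0<..1}. p c t \<in> V"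
    by (intro ballI subsetD[OF UV(5)] subsetD[OF UV(6)] mem C; assumption)+
  with UV(1-4) show ?thesis by metis
qed

text \<open>For each \<open>j\<close>, the legs whose label has \<open>j\<close>-th digit 0 and
  those with digit 2 are divided by a clopen partition of \<open>L - {v}\<close>. The partitions
  together prescribe all ternary digits of the extended label.\<close>

lemma leg_label:
  obtains \<phi> where "continuous_on (L - {v}) \<phi>" "\<And>x. \<phi> x \<in> cantor_set"
    "\<And>c t. \<lbrakk>c \<in> cantor_set; t \<in> {0<..1}\<rbrakk> \<Longrightarrow> \<phi> (p c t) = c"
proof -
  let ?C = "\<lambda>j a. ternary ` {d \<in> cantor_digits. d j \<in> {a}}"
  define R where "R j U V \<longleftrightarrow> openin (top_of_set L) U \<and> openin (top_of_set L) V \<and> U \<union> V = L - {v} \<and> U \<inter> V = {} \<and>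
    (\<forall>c\<in>?C j 0. \<forall>t\<in>{0<..1}. p c t \<in> U) \<and> (\<forall>c\<in>?C j 2. \<forall>t\<in>{0<..1}. p c t \<in> V)" for j U V
  have "\<exists>U V. R j U V" for j
    unfolding R_def
  proof (rule clopen_extension)
    show "?C j 0 \<inter> ?C j 2 = {}"
    proof (rule ccontr)
      assume "?C j 0 \<inter> ?C j 2 \<noteq> {}"
      then obtain d d' where "d \<in> cantor_digits" "d' \<in> cantor_digits" "d j = 0" "d' j = 2" "ternary d = ternary d'"
        by auto
      then show False using inj_onD[OF inj_on_ternary, of d d'] by auto
    qed
  qed (rule compact_ternary_image_digit | auto simp: cantor_set_eq)+
  then obtain U V where R: "\<And>j. R j (U j) (V j)" by metis
  have U: "openin (top_of_set L) (U j)" and V: "openin (top_of_set L) (V j)"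
    and UV: "U j \<union> V j = L - {v}" "U j \<inter> V j = {}"
    and pU: "\<forall>c\<in>?C j 0. \<forall>t\<in>{0<..1}. p c t \<in> U j"
    and pV: "\<forall>c\<in>?C j 2. \<forall>t\<in>{0<..1}. p c t \<in> V j" for j
    using R[of j, unfolded R_def] by - (elim conjE, assumption)+
  \<comment> \<open>Outside \<open>L - {v}\<close> every digit defaults to 2, which keeps
    \<open>\<phi>\<close> inside the Cantor set everywhere.\<close>
  define D :: "'a \<Rightarrow> nat \<Rightarrow> nat" where "D x j = (if x \<in> U j then 0 else 2)" for x j
  have D: "D x \<in> cantor_digits" for x by (auto simp: D_def cantor_digits_def)
  show ?thesis
  proof
    show "continuous_on (L - {v}) (\<lambda>x. ternary (D x))"
    proof (rule continuous_on_ternary[OF D])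
      fix j
      have "continuous_on (U j \<union> V j) (\<lambda>x. real (D x j))"
      proof (rule continuous_on_Un_local_open)
        show "openin (top_of_set (U j \<union> V j)) (U j)" "openin (top_of_set (U j \<union> V j)) (V j)"
          using U[of j] V[of j] UV(1)[of j] by (auto intro: openin_subset_trans)
        show "continuous_on (U j) (\<lambda>x. real (D x j))"
          by (rule continuous_on_eq[OF continuous_on_const[of _ 0]]) (simp add: D_def)
        show "continuous_on (V j) (\<lambda>x. real (D x j))"
          by (rule continuous_on_eq[OF continuous_on_const[of _ 2]]) (use UV(2)[of j] in \<open>auto simp: D_def\<close>)
      qed
      then show "continuous_on (L - {v}) (\<lambda>x. real (D x j))" using UV(1) by simp
    qed
    show "ternary (D x) \<in> cantor_set" for x using D by (simp add: cantor_set_eq)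
    fix c t assume c: "c \<in> cantor_set" and t: "t \<in> {0<..1::real}"
    then obtain d where d: "d \<in> cantor_digits" "c = ternary d" by (auto simp: cantor_set_eq)
    have "D (p c t) j = d j" for j
    proof -
      have "d j = 0 \<or> d j = 2" using d(1) by (auto simp: cantor_digits_def)
      then show ?thesis
      proof
        assume "d j = 0"
        then have "p c t \<in> U j" using d t by (intro pU[rule_format]) auto
        then show ?thesis using \<open>d j = 0\<close> by (simp add: D_def)
      next
        assume "d j = 2"
        then have "p c t \<in> V j" using d t by (intro pV[rule_format]) auto
        then have "p c t \<notin> U j" using UV(2)[of j] by blast
        then show ?thesis using \<open>d j = 2\<close> by (simp add: D_def)
      qed
    qed
    then have "D (p c t) = d" by blast
    then show "ternary (D (p c t)) = c" using d(2) by simp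
  qed
qed

text \<open>On \<open>Y\<close> the coordinate is the second component of \<open>G\<close>; Tietze's
  theorem extends it from the closed set \<open>Y\<close> with values kept in the unit
  interval.\<close>

lemma cone_coordinate:
  obtains u where "continuous_on L u" "u ` L \<subseteq> {0..1}"
    "\<And>c t. \<lbrakk>c \<in> cantor_set; t \<in> {0..1}\<rbrakk> \<Longrightarrow> u (p c t) = t"
proof -
  have Gp: "snd (G (p c t)) = t" if "c \<in> cantor_set" "t \<in> {0..1}" for c t
    using that hom by (simp add: p_def homeomorphism_def)
  have "compact Y"
    using hom compact_standard_cantor_fan
    by (metis compact_continuous_image homeomorphism_def)
  have "normal_space (top_of_set L)"
    by (intro compact_Hausdorff_or_regular_imp_normal_space)
       (simp_all add: compact_space_subtopology L_compact Hausdorff_space_subtopology)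
  moreover have "closedin (top_of_set L) Y"
    using \<open>compact Y\<close> Y_L by (simp add: closed_subset compact_imp_closed)
  moreover have "continuous_map (subtopology (top_of_set L) Y) euclideanreal (\<lambda>y. snd (G y))"
  proof -
    have "continuous_on Y (\<lambda>y. snd (G y))"
      using hom by (intro continuous_on_snd) (simp add: homeomorphism_def)
    then show ?thesis
      using Y_L by (simp add: subtopology_subtopology inf.absorb2)
  qed
  moreover have "(\<lambda>y. snd (G y)) ` Y \<subseteq> {0..1}"
    using Gp by (auto elim!: Y_cases)
  ultimately obtain u where u: "continuous_map (top_of_set L) euclideanreal u"
      "\<And>x. x \<in> Y \<Longrightarrow> u x = snd (G x)" "u ` topspace (top_of_set L) \<subseteq> {0..1}"
    by (rule Tietze_extension_closed_real_interval) auto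
  show ?thesis
    by (rule that[of u]) (use u p_in Gp in auto)
qed

text \<open>The retraction sends \<open>x\<close> to \<open>p (\<phi> x) (u x)\<close>. The extended
  coordinate \<open>u\<close> may vanish away from \<open>v\<close> too; such points simply go to
  \<open>v\<close>.\<close>

lemma retraction_exists: "\<exists>r. retraction L Y r"
proof -
  obtain \<phi> where \<phi>: "continuous_on (L - {v}) \<phi>" "\<And>x. \<phi> x \<in> cantor_set"
    "\<And>c t. \<lbrakk>c \<in> cantor_set; t \<in> {0<..1}\<rbrakk> \<Longrightarrow> \<phi> (p c t) = c"
    by (rule leg_label) blast
  obtain u where u: "continuous_on L u" "u ` L \<subseteq> {0..1}"
    "\<And>c t. \<lbrakk>c \<in> cantor_set; t \<in> {0..1}\<rbrakk> \<Longrightarrow> u (p c t) = t"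
    by (rule cone_coordinate) blast
  have "ternary (\<lambda>_. 0) \<in> cantor_set" by (auto simp: cantor_set_eq cantor_digits_def)
  then have uv: "u v = 0" using u(3)[of _ 0] p_0 top_eq by auto
  \<comment> \<open>\<open>\<phi> v\<close> is a junk value; it is multiplied by \<open>u v = 0\<close>.\<close>
  have "continuous_on L (\<lambda>x. u x * \<phi> x)"
    unfolding continuous_on_eq_continuous_within
  proof
    fix x assume x: "x \<in> L"
    show "continuous (at x within L) (\<lambda>x. u x * \<phi> x)"
    proof (cases "x = v")
      case True
      have lim: "(u \<longlongrightarrow> 0) (at v within L)"
        using u(1) v_in_L uv unfolding continuous_on_def by force
      \<comment> \<open>Labels lie in the unit interval, so the product is squeezed by
        \<open>u\<close>, which tends to 0 at \<open>v\<close>.\<close>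
      have bound: "\<forall>\<^sub>F y in at v within L. norm (u y * \<phi> y) \<le> u y"
        unfolding eventually_at_filter
      proof (intro always_eventually allI impI)
        fix y assume "y \<in> L"
        then have "0 \<le> u y" using u(2) by auto
        moreover have "0 \<le> \<phi> y" "\<phi> y \<le> 1" using \<phi>(2)[of y] cantor_set_subset by auto
        ultimately show "norm (u y * \<phi> y) \<le> u y" by (simp add: mult_left_le)
      qed
      have "((\<lambda>y. u y * \<phi> y) \<longlongrightarrow> 0) (at v within L)"
        by (rule Lim_null_comparison[OF bound lim])
      then show ?thesis using True uv by (simp add: continuous_within)
    next
      case False
      have "continuous_on (L - {v}) (\<lambda>x. u x * \<phi> x)"
        using u(1) \<phi>(1) by (intro continuous_intros) (auto intro: continuous_on_subset)
      then have "continuous (at x within L - {v}) (\<lambda>x. u x * \<phi> x)"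
        using x False by (simp add: continuous_on_eq_continuous_within)
      moreover have "at x within L - {v} = at x within L"
        using False by (intro at_within_nhd[of x "- {v}"]) auto
      ultimately show ?thesis by (simp add: continuous_within)
    qed
  qed
  \<comment> \<open>The label enters \<open>cone_point\<close> only through the product
    \<open>u x * \<phi> x\<close>, so no continuity of \<open>\<phi>\<close> at \<open>v\<close> is
    required.\<close>
  then have "continuous_on L (\<lambda>x. cone_point (\<phi> x) (u x))"
    unfolding cone_point_def using u(1)
    by (intro continuous_on_Pair continuous_on_add continuous_on_divide continuous_on_diff
        continuous_on_const) auto
  moreover have in_fan: "cone_point (\<phi> x) (u x) \<in> standard_cantor_fan" if "x \<in> L" for x
    using that u(2) \<phi>(2) by (intro cone_point_in) auto
  ultimately have "continuous_on L (\<lambda>x. p (\<phi> x) (u x))"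
    unfolding p_def by (intro continuous_on_compose2[OF continuous_on_F]) auto
  moreover have "p (\<phi> x) (u x) \<in> Y" if "x \<in> L" for x
    using that u(2) \<phi>(2) by (intro p_in) auto
  moreover have "p (\<phi> y) (u y) = y" if y: "y \<in> Y" for y
  proof -
    obtain c t where ct: "c \<in> cantor_set" "t \<in> {0..1}" "y = p c t"
      using Y_cases[OF y] .
    show ?thesis
    proof (cases "t = 0")
      case True
      \<comment> \<open>At level 0 the point is \<open>v\<close> whatever the label, so the junk
        value of \<open>\<phi>\<close> is harmless.\<close>
      then have "y = v" using ct(3) p_0 top_eq by simp
      then show ?thesis using uv p_0 top_eq by simp
    next
      case False
      then have "\<phi> y = c" using \<phi>(3)[of c t] ct by auto
      then show ?thesis using u(3)[of c t] ct by simp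
    qed
  qed
  ultimately show ?thesis
    unfolding retraction_def using Y_L by (intro exI[of _ "\<lambda>x. p (\<phi> x) (u x)"]) blast
qed

end

theorem mainTheorem4:
  fixes C :: "'a::metric_space set" and L :: "'b::metric_space set"
    and f :: "'a \<Rightarrow> 'b"
  assumes "cantor_fan C" and "lelek_fan L" and "embedding_into f C L"
  shows "\<exists>r. retraction L (f ` C) r"
proof -
  obtain v where v: "smooth_fan L v"
    using assms(2) unfolding lelek_fan_def by blast
  obtain h k where "homeomorphism standard_cantor_fan C h k"
    using assms(1) homeomorphic_sym unfolding cantor_fan_def homeomorphic_def by metis
  moreover obtain g where "homeomorphism C (f ` C) f g"
    using assms(3) unfolding embedding_into_def by blast
  ultimately have "homeomorphism standard_cantor_fan (f ` C) (f \<circ> h) (k \<circ> g)"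
    by (rule homeomorphism_compose)
  then interpret cantor_fan_in_smooth_fan L v "f ` C" "f \<circ> h" "k \<circ> g"
    using v assms(3) by unfold_locales (auto simp: embedding_into_def)
  show ?thesis by (rule retraction_exists)
qed

end
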